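(* For every $k\in[n-1]$, every integer $m$ with $0\le m\le\min(k-1,n-k-1)$ and any sufficiently large constant $C>0$, $$\sup_{\rho\in\Theta(k,m,C)}\Pr\left(d_H(\widetilde{\mathcal S}_k,\mathcal S_k)>2m\right)= O(n^{-5}).$$
   Context: Model. There are $n$ items indexed by $[n]$. Each pair $(i,j)$, $1\le i<j\le n$, is compared independently with known probability $p\in(0,1]$; the compared pairs form the edge set of a random graph $\mathcal G$. Given $\mathcal G$, the outcomes $Y_{ij}\in\{0,1\}$, $(i,j)\in\mathcal G$, $i<j$, are independent with $\Pr(Y_{ij}=1)=\rho_{ij}$, and $Y_{ji}=1-Y_{ij}$ ($Y_{ij}=1$ means $i$ beats $j$). Here $\rho=(\rho_{ij})\in[0,1]^{n\times n}$ satisfies $\rho_{ij}+\rho_{ji}=1$, $\rho_{ii}=1/2$. Let $\tau_i=\frac1n\sum_{j\in[n]}\rho_{ij}$, let $\tau_{(1)}\ge\tau_{(2)}\ge\dots\ge\tau_{(n)}$ be the ordered values, and let $\mathcal S_k$ be the set of the $k$ indices with the largest $\tau_i$ (ties broken by an arbitrary fixed rule). $d_H$ is the Hamming distance between sets (cardinality of the symmetric difference). For $\varepsilon>0$, $$\Theta(k,m,c)=\left\{\rho\in[0,1]^{n\times n}:\rho+\rho^\top=\mathbf 1\mathbf 1^\top,\ \tau_{(k-m)}-\tau_{(k+m+1)}\ge c\left(\sqrt{\frac{\log n}{np}}+\frac{\log n}{np\varepsilon}\right)\right\}.$$ Estimator. $N_i=\sum_{j\ne i,\,(i,j)\in\mathcal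 G}\mathbf 1(Y_{ij}=1)$ is the number of comparisons won by item $i$ (the edges of $\mathcal G$ being unordered pairs); $W_1,\dots,W_n$ are i.i.d. Laplace with scale $2/\varepsilon$ (density $\frac{\varepsilon}{4}e^{-\varepsilon|x|/2}$), independent of the data; $\widetilde{\mathcal S}_k=\{i\in[n]: N_i+W_i\text{ is among the top }k\text{ largest of }\{N_j+W_j\}_{j\in[n]}\}$. *)

theory Defs
  imports "HOL-Probability.Probability"
begin

definition pairs :: "nat \<Rightarrow> (nat \<times> nat) set" where
  "pairs n = {(i, j). 1 \<le> i \<and> i < j \<and> j \<le> n}"

definition tau :: "nat \<Rightarrow> (nat \<Rightarrow> nat \<Rightarrow> real) \<Rightarrow> nat \<Rightarrow> real" where
  "tau n \<rho> i = (\<Sum>j\<in>{1..n}. \<rho> i j) / real n"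

text \<open>The \<open>l\<close>-th largest of \<open>tau n \<rho> 1, \<dots>, tau n \<rho> n\<close>, counted with multiplicity, for
  \<open>1 \<le> l \<le> n\<close>.\<close>

definition tau_ord :: "nat \<Rightarrow> (nat \<Rightarrow> nat \<Rightarrow> real) \<Rightarrow> nat \<Rightarrow> real" where
  "tau_ord n \<rho> l = rev (sort (map (tau n \<rho>) [1..<n + 1])) ! (l - 1)"

text \<open>A tie-breaking rule is a ranking \<open>r\<close> of the items, injective on \<open>{1..n}\<close>; among items with
  equal values the one with the smaller rank is preferred.\<close>

definition top_set :: "nat \<Rightarrow> (nat \<Rightarrow> nat) \<Rightarrow> nat \<Rightarrow> (nat \<Rightarrow> real) \<Rightarrow> nat set" where
  "top_set n r k x =
     {i \<in> {1..n}. card {j \<in> {1..n}. x j > x i \<or> (x j = x i \<and> r j < r i)} < k}"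

definition hamming_dist :: "'a set \<Rightarrow> 'a set \<Rightarrow> nat" where
  "hamming_dist A B = card (sym_diff A B)"

text \<open>An \<open>n \<times> n\<close> matrix is a function \<open>nat \<Rightarrow> nat \<Rightarrow> real\<close> of which only the entries indexed by
  \<open>{1..n}\<close> matter. The diagonal condition \<open>\<rho> i i = 1/2\<close> is the case \<open>i = j\<close> of
  \<open>\<rho> i j + \<rho> j i = 1\<close>.\<close>

definition Theta ::
  "nat \<Rightarrow> real \<Rightarrow> real \<Rightarrow> nat \<Rightarrow> nat \<Rightarrow> real \<Rightarrow> (nat \<Rightarrow> nat \<Rightarrow> real) set" where
  "Theta n p \<epsilon> k m c =
     {\<rho>. (\<forall>i\<in>{1..n}. \<forall>j\<in>{1..n}. \<rho> i j \<in> {0..1}) \<and>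
         (\<forall>i\<in>{1..n}. \<forall>j\<in>{1..n}. \<rho> i j + \<rho> j i = 1) \<and>
         tau_ord n \<rho> (k - m) - tau_ord n \<rho> (k + m + 1)
           \<ge> c * (sqrt (ln (real n) / (real n * p)) + ln (real n) / (real n * p * \<epsilon>))}"

definition graph_pmf :: "nat \<Rightarrow> real \<Rightarrow> (nat \<times> nat) set pmf" where
  "graph_pmf n p =
     map_pmf (\<lambda>f. {e \<in> pairs n. f e}) (Pi_pmf (pairs n) False (\<lambda>_. bernoulli_pmf p))"

text \<open>Joint law of the comparison graph and, given the graph, of the outcomes \<open>Y (i, j)\<close> on its
  edges, \<open>i < j\<close>; off the graph \<open>Y\<close> takes the dummy value \<open>False\<close>.\<close>

definition data_pmf ::
  "nat \<Rightarrow> real \<Rightarrow> (nat \<Rightarrow> nat \<Rightarrow> real) \<Rightarrow> ((nat \<times> nat) set \<times> (nat \<times> nat \<Rightarrow> bool)) pmf" where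
  "data_pmf n p \<rho> =
     do {
       G \<leftarrow> graph_pmf n p;
       Y \<leftarrow> Pi_pmf G False (\<lambda>(i, j). bernoulli_pmf (\<rho> i j));
       return_pmf (G, Y)
     }"

definition laplace_density :: "real \<Rightarrow> real \<Rightarrow> real" where
  "laplace_density b x = exp (- \<bar>x\<bar> / b) / (2 * b)"

definition laplace :: "real \<Rightarrow> real measure" where
  "laplace b = density lborel (\<lambda>x. ennreal (laplace_density b x))"

text \<open>Sample points are \<open>((G, Y), W)\<close>; the noise \<open>W\<close> is independent of the data.\<close>

definition model ::
  "nat \<Rightarrow> real \<Rightarrow> real \<Rightarrow> (nat \<Rightarrow> nat \<Rightarrow> real) \<Rightarrow>
     (((nat \<times> nat) set \<times> (nat \<times> nat \<Rightarrow> bool)) \<times> (nat \<Rightarrow> real)) measure" where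
  "model n p \<epsilon> \<rho> =
     measure_pmf (data_pmf n p \<rho>) \<Otimes>\<^sub>M PiM {1..n} (\<lambda>_. laplace (2 / \<epsilon>))"

text \<open>Only \<open>Y (i, j)\<close> with \<open>i < j\<close> is sampled; \<open>beats\<close> extends it by \<open>Y\<^bsub>ji\<^esub> = 1 - Y\<^bsub>ij\<^esub>\<close>.\<close>

definition beats :: "(nat \<times> nat \<Rightarrow> bool) \<Rightarrow> nat \<Rightarrow> nat \<Rightarrow> bool" where
  "beats Y i j = (if i < j then Y (i, j) else \<not> Y (j, i))"

definition wins :: "nat \<Rightarrow> (nat \<times> nat) set \<Rightarrow> (nat \<times> nat \<Rightarrow> bool) \<Rightarrow> nat \<Rightarrow> nat" where
  "wins n G Y i = card {j \<in> {1..n}. j \<noteq> i \<and> (min i j, max i j) \<in> G \<and> beats Y i j}"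

definition S_true :: "nat \<Rightarrow> (nat \<Rightarrow> nat) \<Rightarrow> nat \<Rightarrow> (nat \<Rightarrow> nat \<Rightarrow> real) \<Rightarrow> nat set" where
  "S_true n r k \<rho> = top_set n r k (tau n \<rho>)"

definition S_est ::
  "nat \<Rightarrow> (nat \<Rightarrow> nat) \<Rightarrow> nat \<Rightarrow>
     ((nat \<times> nat) set \<times> (nat \<times> nat \<Rightarrow> bool)) \<times> (nat \<Rightarrow> real) \<Rightarrow> nat set" where
  "S_est n r k = (\<lambda>((G, Y), W). top_set n r k (\<lambda>i. real (wins n G Y i) + W i))"

end

theory Submission
  imports Defs "HOL-Real_Asymp.Real_Asymp"
begin

text \<open>
  Put \<open>s = sqrt (ln n / (n p))\<close>. As all \<open>\<tau>\<^sub>i\<close> lie in \<open>[0, 1]\<close>, for \<open>C \<ge> 24\<close> the class \<open>\<Theta>\<close> is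
  empty unless \<open>s \<le> 1\<close>; so in the sparse regime, where binomial tails are no longer Gaussian, there
  is nothing to prove. When \<open>s \<le> 1\<close>, the moment generating function of \<open>N\<^sub>i\<close> at \<open>s\<close> and \<open>-s\<close> gives
  \<open>\<bar>N\<^sub>i - E N\<^sub>i\<bar> < 7 sqrt (n p ln n)\<close> up to probability \<open>2 n\<^sup>-\<^sup>6\<close>, and \<open>\<bar>W\<^sub>i\<bar> < 12 ln n / \<epsilon>\<close> up to
  probability \<open>n\<^sup>-\<^sup>6\<close>. As \<open>E N\<^sub>i = p (n \<tau>\<^sub>i - 1/2)\<close>, when all these bounds hold the noisy scores order
  correctly any item with \<open>\<tau>\<^sub>i \<ge> \<tau>\<^bsub>(k-m)\<^esub>\<close> and any item with \<open>\<tau>\<^sub>j \<le> \<tau>\<^bsub>(k+m+1)\<^esub>\<close>. The true top-\<open>k\<close>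
  set contains at most \<open>m\<close> items not of the first kind and misses at most \<open>m\<close> items not of the
  second kind, so more than \<open>m\<close> exchanges would produce a misordered pair.
\<close>

subsection \<open>Order statistics and top sets\<close>

text \<open>Sorting only permutes the multiset of values, so items with a given property of their
  value can be counted by 0-based position in the decreasing list.\<close>

lemma card_eq_card_nth_rev_sort:
  "card {i \<in> {1..n}. P (f i)} =
     card {t. t < n \<and> P (rev (sort (map f [1..<n + 1])) ! t)}"
proof -
  let ?ys = "rev (sort (map f [1..<n + 1]))"
  have "card {t. t < n \<and> P (?ys ! t)} = length (filter P ?ys)"
    by (simp add: length_filter_conv_card del: upt_Suc)
  also have "\<dots> = length (filter P (map f [1..<n + 1]))"
    by (metis mset_filter mset_rev mset_sort size_mset)
  also have "\<dots> = length (filter (P \<circ> f) [1..<n + 1])"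
    by (simp add: filter_map del: upt_Suc)
  also have "\<dots> = card {i \<in> {1..n}. P (f i)}"
    by (subst distinct_length_filter) (auto intro!: arg_cong[where f = card])
  finally show ?thesis by simp
qed

lemma nth_rev_sort_antimono:
  fixes xs :: "'a::linorder list"
  assumes "s \<le> t" "t < length xs"
  shows "rev (sort xs) ! t \<le> rev (sort xs) ! s"
proof -
  have "sort xs ! (length xs - Suc t) \<le> sort xs ! (length xs - Suc s)"
    using assms by (intro sorted_nth_mono) auto
  then show ?thesis
    using assms by (simp add: rev_nth)
qed

text \<open>The first \<open>l\<close> positions of the decreasing list carry values at least the
  \<open>l\<close>-th one; a tie at the threshold can only add items.\<close>

lemma card_ge_tau_ord:
  assumes "1 \<le> l" "l \<le> n"
  shows "l \<le> card {i \<in> {1..n}. tau_ord n \<rho> l \<le> tau n \<rho> i}"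
proof -
  let ?ys = "rev (sort (map (tau n \<rho>) [1..<n + 1]))"
  have "{..<l} \<subseteq> {t. t < n \<and> tau_ord n \<rho> l \<le> ?ys ! t}"
    using assms by (auto simp: tau_ord_def intro!: nth_rev_sort_antimono)
  then have "card {..<l} \<le> card {t. t < n \<and> tau_ord n \<rho> l \<le> ?ys ! t}"
    by (intro card_mono) auto
  then show ?thesis
    by (subst card_eq_card_nth_rev_sort) simp
qed

text \<open>Dual count: the positions \<open>l - 1, ..., n - 1\<close>, which are
  \<open>n + 1 - l\<close> in number, carry values at most the \<open>l\<close>-th largest.\<close>

lemma card_le_tau_ord:
  assumes "1 \<le> l" "l \<le> n"
  shows "n + 1 - l \<le> card {i \<in> {1..n}. tau n \<rho> i \<le> tau_ord n \<rho> l}"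
proof -
  let ?ys = "rev (sort (map (tau n \<rho>) [1..<n + 1]))"
  have "{l - 1..<n} \<subseteq> {t. t < n \<and> ?ys ! t \<le> tau_ord n \<rho> l}"
    using assms by (auto simp: tau_ord_def intro!: nth_rev_sort_antimono)
  then have "card {l - 1..<n} \<le> card {t. t < n \<and> ?ys ! t \<le> tau_ord n \<rho> l}"
    by (intro card_mono) auto
  then show ?thesis
    using assms by (subst card_eq_card_nth_rev_sort) simp
qed

lemma tau_ord_in_image:
  assumes "1 \<le> l" "l \<le> n"
  shows "tau_ord n \<rho> l \<in> tau n \<rho> ` {1..n}"
proof -
  have "tau_ord n \<rho> l \<in> set (rev (sort (map (tau n \<rho>) [1..<n + 1])))"
    unfolding tau_ord_def using assms by (intro nth_mem) simp
  then show ?thesis by auto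
qed

section \<open>Top sets under a tie-breaking rule\<close>

definition preferred :: "(nat \<Rightarrow> nat) \<Rightarrow> (nat \<Rightarrow> real) \<Rightarrow> nat \<Rightarrow> nat \<Rightarrow> bool" where
  "preferred r x j i \<longleftrightarrow> x j > x i \<or> (x j = x i \<and> r j < r i)"

lemma top_set_eq: "top_set n r k x = {i \<in> {1..n}. card {j \<in> {1..n}. preferred r x j i} < k}"
  by (simp add: top_set_def preferred_def)

lemma top_set_subset: "top_set n r k x \<subseteq> {1..n}"
  by (auto simp: top_set_def)

lemma finite_top_set [simp]: "finite (top_set n r k x)"
  by (rule finite_subset[OF top_set_subset]) simp

text \<open>If \<open>x j > x i\<close>, every item preferred to \<open>j\<close> is also preferred
  to \<open>i\<close>, so \<open>j\<close> has fewer than \<open>k\<close> items ahead of it as soon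
  as \<open>i\<close> does.\<close>

lemma top_set_ge_outside:
  assumes "i \<in> top_set n r k x" "j \<in> {1..n} - top_set n r k x"
  shows "x j \<le> x i"
proof (rule ccontr)
  assume "\<not> x j \<le> x i"
  then have "{l \<in> {1..n}. preferred r x l j} \<subseteq> {l \<in> {1..n}. preferred r x l i}"
    by (auto simp: preferred_def)
  then have "card {l \<in> {1..n}. preferred r x l j} \<le> card {l \<in> {1..n}. preferred r x l i}"
    by (intro card_mono) auto
  then show False
    using assms by (auto simp: top_set_eq)
qed

text \<open>The number \<open>c i\<close> of items preferred to \<open>i\<close> is the 0-based rank
  of \<open>i\<close>. Injectivity of \<open>r\<close> makes preference a strict linear order, so
  \<open>c\<close> maps the items bijectively onto the ranks below \<open>n\<close>, and the top set
  is the preimage of the ranks below \<open>k\<close>.\<close>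

lemma card_top_set:
  assumes r: "inj_on r {1..n}" and "k \<le> n"
  shows "card (top_set n r k x) = k"
proof -
  define c where "c i = card {j \<in> {1..n}. preferred r x j i}" for i
  have less: "c j < c i" if "preferred r x j i" "j \<in> {1..n}" for i j
    unfolding c_def using that by (intro psubset_card_mono) (auto simp: preferred_def)
  have inj: "inj_on c {1..n}"
  proof (rule inj_onI, rule ccontr)
    fix i j assume *: "i \<in> {1..n}" "j \<in> {1..n}" "c i = c j" "i \<noteq> j"
    then have "r i \<noteq> r j"
      using r by (auto dest: inj_onD)
    then have "preferred r x i j \<or> preferred r x j i"
      by (auto simp: preferred_def)
    then show False
      using less * by fastforce
  qed
  have "c i < n" if "i \<in> {1..n}" for i
  proof -
    have "c i \<le> card ({1..n} - {i})"
      unfolding c_def by (intro card_mono) (auto simp: preferred_def)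
    then show ?thesis
      using that by auto
  qed
  then have "c ` {1..n} = {..<n}"
    using inj by (intro card_subset_eq) (auto simp: card_image)
  moreover have "c ` {i \<in> {1..n}. c i < k} = c ` {1..n} \<inter> {..<k}"
    by auto
  ultimately have "c ` {i \<in> {1..n}. c i < k} = {..<k}"
    using \<open>k \<le> n\<close> by auto
  moreover have "inj_on c {i \<in> {1..n}. c i < k}"
    using inj by (rule inj_on_subset) auto
  ultimately have "card {i \<in> {1..n}. c i < k} = k"
    by (metis card_image card_lessThan)
  then show ?thesis
    by (simp add: top_set_eq c_def)
qed

text \<open>Either the top set contains all items with value at least \<open>a\<close>, leaving room
  for at most \<open>m\<close> others, or it misses one of them, and then every member has value at
  least \<open>a\<close>.\<close>

lemma card_top_set_less_le:
  assumes "inj_on r {1..n}" "k \<le> n" and A: "k - m \<le> card {i \<in> {1..n}. a \<le> x i}"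
  shows "card {i \<in> top_set n r k x. x i < a} \<le> m"
proof (cases "{i \<in> {1..n}. a \<le> x i} \<subseteq> top_set n r k x")
  case True
  have "{i \<in> top_set n r k x. x i < a} = top_set n r k x - {i \<in> {1..n}. a \<le> x i}"
    using top_set_subset[of n r k x] by auto
  then have "card {i \<in> top_set n r k x. x i < a} = k - card {i \<in> {1..n}. a \<le> x i}"
    using True card_top_set[OF assms(1,2)] by (simp add: card_Diff_subset)
  then show ?thesis using A by simp
next
  case False
  then obtain j where "j \<in> {1..n} - top_set n r k x" "a \<le> x j" by auto
  then have "{i \<in> top_set n r k x. x i < a} = {}"
    using top_set_ge_outside[of _ n r k x j] by force
  then show ?thesis by (simp only: card.empty)
qed

text \<open>Same dichotomy for the complement, which has \<open>n - k\<close> elements.\<close>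

lemma card_outside_top_set_greater_le:
  assumes "inj_on r {1..n}" "k \<le> n" and B: "n - k - m \<le> card {i \<in> {1..n}. x i \<le> b}"
  shows "card {i \<in> {1..n} - top_set n r k x. b < x i} \<le> m"
proof (cases "{i \<in> {1..n}. x i \<le> b} \<subseteq> {1..n} - top_set n r k x")
  case True
  have "{i \<in> {1..n} - top_set n r k x. b < x i} =
      ({1..n} - top_set n r k x) - {i \<in> {1..n}. x i \<le> b}"
    by auto
  then have "card {i \<in> {1..n} - top_set n r k x. b < x i} = n - k - card {i \<in> {1..n}. x i \<le> b}"
    using True card_top_set[OF assms(1,2)] top_set_subset[of n r k x]
    by (simp add: card_Diff_subset)
  then show ?thesis using B by simp
next
  case False
  then obtain i where "i \<in> top_set n r k x" "x i \<le> b" by auto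
  then have "{i \<in> {1..n} - top_set n r k x. b < x i} = {}"
    using top_set_ge_outside[of i n r k x] by force
  then show ?thesis by (simp only: card.empty)
qed

text \<open>The deterministic core. Both top sets have \<open>k\<close> elements, so a distance
  above \<open>2 * m\<close> puts more than \<open>m\<close> items in each one-sided difference. The
  two preceding counts then yield an \<open>i\<close> wrongly dropped with
  \<open>a \<le> x i\<close> and a \<open>j\<close> wrongly included with
  \<open>x j \<le> b\<close>, and \<open>sep\<close> contradicts the choice made by
  \<open>y\<close>.\<close>

lemma hamming_dist_top_set_le:
  assumes r: "inj_on r {1..n}" "k \<le> n"
    and A: "k - m \<le> card {i \<in> {1..n}. a \<le> x i}"
    and B: "n - k - m \<le> card {i \<in> {1..n}. x i \<le> b}"
    and sep: "\<And>i j. i \<in> {1..n} \<Longrightarrow> j \<in> {1..n} \<Longrightarrow> a \<le> x i \<Longrightarrow> x j \<le> b \<Longrightarrow> y j < y i"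
  shows "hamming_dist (top_set n r k y) (top_set n r k x) \<le> 2 * m"
proof (rule ccontr)
  assume far: "\<not> ?thesis"
  let ?E = "top_set n r k y" and ?T = "top_set n r k x"
  have "card ?E = card ?T"
    using card_top_set[OF r] by simp
  then have eq: "card (?E - ?T) = card (?T - ?E)"
    by (simp add: card_le_sym_Diff order_antisym)
  have "hamming_dist ?E ?T = card (?E - ?T) + card (?T - ?E)"
    unfolding hamming_dist_def by (intro card_Un_disjoint) auto
  then have gt: "m < card (?T - ?E)" "m < card (?E - ?T)"
    using far eq by auto
  have "\<not> ?T - ?E \<subseteq> {i \<in> ?T. x i < a}"
  proof
    assume "?T - ?E \<subseteq> {i \<in> ?T. x i < a}"
    then have "card (?T - ?E) \<le> card {i \<in> ?T. x i < a}"
      by (intro card_mono) simp_all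
    then show False
      using gt(1) card_top_set_less_le[OF r A] by simp
  qed
  then obtain i where i: "i \<in> ?T - ?E" "\<not> x i < a"
    by blast
  have "\<not> ?E - ?T \<subseteq> {i \<in> {1..n} - ?T. b < x i}"
  proof
    assume "?E - ?T \<subseteq> {i \<in> {1..n} - ?T. b < x i}"
    then have "card (?E - ?T) \<le> card {i \<in> {1..n} - ?T. b < x i}"
      by (intro card_mono) simp_all
    then show False
      using gt(2) card_outside_top_set_greater_le[OF r B] by simp
  qed
  then obtain j where j: "j \<in> ?E - ?T" "\<not> b < x j"
    using top_set_subset[of n r k y] by blast
  have "i \<in> {1..n}" "j \<in> {1..n}"
    using i j top_set_subset by blast+
  then have "y j < y i"
    using i j by (intro sep) simp_all
  moreover have "y i \<le> y j"
    using i j \<open>i \<in> {1..n}\<close> by (intro top_set_ge_outside[of j n r k y i]) auto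
  ultimately show False by simp
qed

subsection \<open>Concentration of the number of wins\<close>

lemma exp_le_quadratic:
  fixes x :: real
  assumes "\<bar>x\<bar> \<le> 1"
  shows "exp x \<le> 1 + x + x\<^sup>2"
proof (cases "0 \<le> x")
  case True
  then show ?thesis using assms exp_bound by simp
next
  case False
  define y where "y = - x"
  have y: "0 < y" "y \<le> 1"
    using False assms by (auto simp: y_def)
  \<comment> \<open>The second factor is a Taylor lower bound for \<open>exp y\<close>, so a product
    of at least 1 shows that \<open>1 - y + y\<^sup>2\<close> dominates
    \<open>exp (- y)\<close>.\<close>
  have "1 + y\<^sup>2 / 2 + y ^ 3 / 2 + y ^ 4 / 2 = (1 - y + y\<^sup>2) * (1 + y + y\<^sup>2 / 2)"
    by (simp add: field_simps power2_eq_square power3_eq_cube power4_eq_xxxx)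
  then have "1 \<le> (1 - y + y\<^sup>2) * (1 + y + y\<^sup>2 / 2)"
    using y by (metis add_increasing2 divide_nonneg_pos le_less less_eq_real_def
        zero_le_power zero_less_numeral order_refl)
  also have "\<dots> \<le> (1 - y + y\<^sup>2) * exp y"
    using y by (intro mult_left_mono exp_lower_Taylor_quadratic) auto
  finally have "exp (- y) \<le> 1 - y + y\<^sup>2"
    by (simp add: exp_minus field_simps)
  then show ?thesis by (simp add: y_def)
qed

section \<open>Finite supports and conditioning on the graph\<close>

lemma finite_pairs [simp]: "finite (pairs n)"
  by (rule finite_subset[of _ "{1..n} \<times> {1..n}"]) (auto simp: pairs_def)

lemma finite_set_pmf_Pi_pmf:
  assumes "finite A" "\<And>x. x \<in> A \<Longrightarrow> finite (set_pmf (p x))"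
  shows "finite (set_pmf (Pi_pmf A dflt p))"
  unfolding set_Pi_pmf[OF assms(1)] using assms by (intro finite_PiE_dflt) auto

lemma finite_set_pmf_bool [simp]: "finite (set_pmf (p :: bool pmf))"
  by (rule finite_subset[OF subset_UNIV]) simp

lemma finite_set_pmf_outcomes:
  "finite G \<Longrightarrow> finite (set_pmf (Pi_pmf G False (q :: _ \<Rightarrow> bool pmf)))"
  by (intro finite_set_pmf_Pi_pmf) auto

lemma finite_set_graph_pmf: "finite (set_pmf (graph_pmf n p))"
  by (auto simp: graph_pmf_def intro!: finite_set_pmf_Pi_pmf)

lemma set_graph_pmf_subset: "G \<in> set_pmf (graph_pmf n p) \<Longrightarrow> G \<subseteq> pairs n"
  by (auto simp: graph_pmf_def)

lemma finite_graph: "G \<in> set_pmf (graph_pmf n p) \<Longrightarrow> finite G"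
  using set_graph_pmf_subset finite_pairs finite_subset by metis

text \<open>Makes every real function of the data integrable.\<close>

lemma finite_set_data_pmf: "finite (set_pmf (data_pmf n p \<rho>))"
  by (auto simp: data_pmf_def finite_set_graph_pmf finite_graph
      simp del: UN_simps intro!: finite_UN_I finite_set_pmf_outcomes)

lemma expectation_data_pmf:
  fixes h :: "_ \<Rightarrow> real"
  shows "measure_pmf.expectation (data_pmf n p \<rho>) h =
    measure_pmf.expectation (graph_pmf n p) (\<lambda>G.
      measure_pmf.expectation (Pi_pmf G False (\<lambda>(i, j). bernoulli_pmf (\<rho> i j))) (\<lambda>Y. h (G, Y)))"
proof -
  let ?A = "set_pmf (graph_pmf n p)"
  have *: "finite (set_pmf (Pi_pmf G False (\<lambda>(i, j). bernoulli_pmf (\<rho> i j))))" if "G \<in> ?A" for G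
    using finite_graph[OF that] by (rule finite_set_pmf_outcomes)
  have "measure_pmf.expectation (data_pmf n p \<rho>) h =
    (\<Sum>G\<in>?A. pmf (graph_pmf n p) G *\<^sub>R measure_pmf.expectation
        (map_pmf (Pair G) (Pi_pmf G False (\<lambda>(i, j). bernoulli_pmf (\<rho> i j)))) h)"
    unfolding data_pmf_def map_pmf_def[symmetric]
    by (rule pmf_expectation_bind) (auto simp: finite_set_graph_pmf *)
  also have "\<dots> = measure_pmf.expectation (graph_pmf n p) (\<lambda>G.
      measure_pmf.expectation (Pi_pmf G False (\<lambda>(i, j). bernoulli_pmf (\<rho> i j))) (\<lambda>Y. h (G, Y)))"
    by (subst integral_measure_pmf[of ?A]) (auto simp: finite_set_graph_pmf)
  finally show ?thesis .
qed

section \<open>Wins as a count over edges\<close>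

definition wins_edge :: "nat \<Rightarrow> nat \<times> nat \<Rightarrow> bool \<Rightarrow> bool" where
  "wins_edge i e y \<longleftrightarrow> fst e = i \<and> y \<or> snd e = i \<and> \<not> y"

text \<open>Opponents of \<open>i\<close> correspond to edges at \<open>i\<close>, the inverse map
  taking the other endpoint. Whether an edge counts then depends on its own outcome only, as
  independence across edges requires.\<close>

lemma wins_eq_card_edges:
  assumes G: "G \<subseteq> pairs n" and i: "i \<in> {1..n}"
  shows "wins n G Y i = card {e \<in> G. wins_edge i e (Y e)}"
proof -
  have "bij_betw (\<lambda>j. (min i j, max i j))
      {j \<in> {1..n}. j \<noteq> i \<and> (min i j, max i j) \<in> G \<and> beats Y i j} {e \<in> G. wins_edge i e (Y e)}"
    using G i
    by (intro bij_betw_byWitness[where f' = "\<lambda>e. if fst e = i then snd e else fst e"])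
       (auto simp: wins_edge_def beats_def pairs_def min_def max_def split: if_splits)
  then show ?thesis
    unfolding wins_def by (rule bij_betw_same_card)
qed

lemma exp_wins_eq_prod:
  assumes "G \<subseteq> pairs n" "i \<in> {1..n}"
  shows "exp (s * real (wins n G Y i)) = (\<Prod>e\<in>G. if wins_edge i e (Y e) then exp s else 1)"
proof -
  have G: "finite G"
    using assms(1) finite_pairs by (rule finite_subset)
  then have "(\<Prod>e\<in>G. if wins_edge i e (Y e) then exp s else 1) = exp s ^ wins n G Y i"
    by (simp add: prod.If_cases wins_eq_card_edges[OF assms] Collect_conj_eq Int_commute)
  then show ?thesis
    by (simp add: exp_of_nat_mult[symmetric] mult.commute)
qed

text \<open>Conditional probability that \<open>i\<close> wins the comparison \<open>e\<close>,
  given that it takes place; edges away from \<open>i\<close> get 0 and so contribute a factor 1 to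
  the moment generating function.\<close>

definition win_prob :: "(nat \<Rightarrow> nat \<Rightarrow> real) \<Rightarrow> nat \<Rightarrow> nat \<times> nat \<Rightarrow> real" where
  "win_prob \<rho> i e = (if fst e = i then \<rho> i (snd e) else if snd e = i then \<rho> i (fst e) else 0)"

lemma sum_win_prob:
  assumes "i \<in> {1..n}"
  shows "(\<Sum>e\<in>pairs n. win_prob \<rho> i e) = (\<Sum>j\<in>{1..n} - {i}. \<rho> i j)"
proof -
  have "(\<Sum>e\<in>pairs n. win_prob \<rho> i e) = (\<Sum>e\<in>{e \<in> pairs n. fst e = i \<or> snd e = i}. win_prob \<rho> i e)"
    by (intro sum.mono_neutral_right) (auto simp: win_prob_def)
  also have "\<dots> = (\<Sum>j\<in>{1..n} - {i}. \<rho> i j)"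
    using assms
    by (intro sum.reindex_bij_witness[where
          i = "\<lambda>j. (min i j, max i j)" and j = "\<lambda>e. if fst e = i then snd e else fst e"])
       (auto simp: win_prob_def pairs_def min_def max_def split: if_splits)
  finally show ?thesis .
qed

section \<open>Chernoff bounds for the wins\<close>

locale comparison_matrix =
  fixes n :: nat and p :: real and \<rho> :: "nat \<Rightarrow> nat \<Rightarrow> real"
  assumes p: "0 \<le> p" "p \<le> 1"
    and range: "\<And>i j. i \<in> {1..n} \<Longrightarrow> j \<in> {1..n} \<Longrightarrow> \<rho> i j \<in> {0..1}"
    and skew: "\<And>i j. i \<in> {1..n} \<Longrightarrow> j \<in> {1..n} \<Longrightarrow> \<rho> i j + \<rho> j i = 1"
begin

text \<open>The expected number of wins. The \<open>1 / 2\<close> removes the diagonal term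
  contained in \<open>tau\<close>; it is the same for all items and cancels in differences.\<close>

definition mean_wins :: "nat \<Rightarrow> real" where
  "mean_wins i = p * (real n * tau n \<rho> i - 1 / 2)"

lemma mean_wins_eq:
  assumes "i \<in> {1..n}"
  shows "mean_wins i = p * (\<Sum>j\<in>{1..n} - {i}. \<rho> i j)"
proof -
  have "\<rho> i i = 1 / 2"
    using skew[OF assms assms] by simp
  moreover have "(\<Sum>j\<in>{1..n}. \<rho> i j) = \<rho> i i + (\<Sum>j\<in>{1..n} - {i}. \<rho> i j)"
    using assms by (intro sum.remove) auto
  ultimately show ?thesis
    using assms by (simp add: mean_wins_def tau_def)
qed

lemma mean_wins_le:
  assumes "i \<in> {1..n}"
  shows "mean_wins i \<le> real n * p"
proof -
  have "(\<Sum>j\<in>{1..n} - {i}. \<rho> i j) \<le> (\<Sum>j\<in>{1..n} - {i}. 1)"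
    using range assms by (intro sum_mono) auto
  also have "\<dots> \<le> real n"
    using assms by simp
  finally show ?thesis
    using p mult_left_mono by (fastforce simp: mean_wins_eq[OF assms] mult.commute)
qed

lemma mgf_outcome:
  assumes "e \<in> pairs n" "i \<in> {1..n}"
  shows "measure_pmf.expectation (case e of (i, j) \<Rightarrow> bernoulli_pmf (\<rho> i j))
      (\<lambda>y. if wins_edge i e y then exp s else 1) = 1 + win_prob \<rho> i e * (exp s - 1)"
proof -
  obtain a b where e: "e = (a, b)" by force
  have ab: "a \<in> {1..n}" "b \<in> {1..n}" "a \<noteq> b"
    using assms by (auto simp: e pairs_def)
  have "0 \<le> \<rho> a b" "\<rho> a b \<le> 1" "\<rho> b a = 1 - \<rho> a b"
    using range[OF ab(1,2)] skew[OF ab(1,2)] by auto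
  then show ?thesis
    using ab by (auto simp: e wins_edge_def win_prob_def) (simp_all add: algebra_simps)
qed

text \<open>Averaging first over outcomes and then over edge inclusion gives one factor
  \<open>1 + p * q * (exp s - 1)\<close> per pair, with \<open>q\<close> the winning probability;
  \<open>1 + x \<le> exp x\<close> turns the product into a Poisson moment generating
  function.\<close>

lemma mgf_wins_le:
  assumes i: "i \<in> {1..n}"
  shows "measure_pmf.expectation (data_pmf n p \<rho>) (\<lambda>(G, Y). exp (s * real (wins n G Y i)))
    \<le> exp (mean_wins i * (exp s - 1))"
proof -
  let ?\<mu> = "\<lambda>e. 1 + win_prob \<rho> i e * (exp s - 1)"
  have win_prob: "0 \<le> win_prob \<rho> i e" "win_prob \<rho> i e \<le> 1" if "e \<in> pairs n" for e
    using that range i by (auto simp: win_prob_def pairs_def)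
  have \<mu>: "0 \<le> ?\<mu> e" if "e \<in> pairs n" for e
  proof -
    have "?\<mu> e = (1 - win_prob \<rho> i e) + win_prob \<rho> i e * exp s"
      by (simp add: algebra_simps)
    moreover have "0 \<le> (1 - win_prob \<rho> i e) + win_prob \<rho> i e * exp s"
      using win_prob[OF that] by simp
    ultimately show ?thesis by linarith
  qed
  have "measure_pmf.expectation (data_pmf n p \<rho>) (\<lambda>(G, Y). exp (s * real (wins n G Y i))) =
      measure_pmf.expectation (graph_pmf n p) (\<lambda>G. \<Prod>e\<in>G. ?\<mu> e)"
    unfolding expectation_data_pmf prod.case
  proof (intro integral_cong_AE AE_pmfI)
    fix G assume "G \<in> set_pmf (graph_pmf n p)"
    then have G: "G \<subseteq> pairs n" "finite G"
      by (auto dest: set_graph_pmf_subset finite_graph)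
    show "measure_pmf.expectation (Pi_pmf G False (\<lambda>(i, j). bernoulli_pmf (\<rho> i j)))
        (\<lambda>Y. exp (s * real (wins n G Y i))) = (\<Prod>e\<in>G. ?\<mu> e)"
      unfolding exp_wins_eq_prod[OF G(1) i]
    proof (subst expectation_prod_Pi_pmf)
      show "(\<Prod>e\<in>G. measure_pmf.expectation (case e of (i, j) \<Rightarrow> bernoulli_pmf (\<rho> i j))
          (\<lambda>y. if wins_edge i e y then exp s else 1)) = (\<Prod>e\<in>G. ?\<mu> e)"
        using G(1) i by (intro prod.cong refl mgf_outcome) auto
    qed (auto simp: G intro!: integrable_measure_pmf_finite)
  qed simp_all
  \<comment> \<open>The product over the random graph becomes one over all pairs, with factor 1 off
    the graph, so that the independent inclusion indicators factorise.\<close>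
  also have "\<dots> = measure_pmf.expectation (Pi_pmf (pairs n) False (\<lambda>_. bernoulli_pmf p))
      (\<lambda>f. \<Prod>e\<in>pairs n. if f e then ?\<mu> e else 1)"
    by (simp add: graph_pmf_def prod.inter_filter)
  also have "\<dots> = (\<Prod>e\<in>pairs n. measure_pmf.expectation (bernoulli_pmf p) (\<lambda>y. if y then ?\<mu> e else 1))"
    using \<mu> by (intro expectation_prod_Pi_pmf) (auto intro!: integrable_measure_pmf_finite)
  also have "\<dots> = (\<Prod>e\<in>pairs n. 1 + p * win_prob \<rho> i e * (exp s - 1))"
    using p by (simp add: algebra_simps)
  also have "\<dots> \<le> (\<Prod>e\<in>pairs n. exp (p * win_prob \<rho> i e * (exp s - 1)))"
  proof (intro prod_mono conjI exp_ge_add_one_self)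
    fix e assume e: "e \<in> pairs n"
    \<comment> \<open>A convex combination of 1 and the nonnegative \<open>?\<mu> e\<close>;
      \<open>prod_mono\<close> needs the smaller factors to be nonnegative.\<close>
    have "1 + p * win_prob \<rho> i e * (exp s - 1) = (1 - p) + p * ?\<mu> e"
      by (simp add: algebra_simps)
    moreover have "0 \<le> (1 - p) + p * ?\<mu> e"
      using p mult_nonneg_nonneg[OF p(1) \<mu>[OF e]] by linarith
    ultimately show "0 \<le> 1 + p * win_prob \<rho> i e * (exp s - 1)"
      by linarith
  qed
  also have "\<dots> = exp (p * (\<Sum>e\<in>pairs n. win_prob \<rho> i e) * (exp s - 1))"
    by (simp add: exp_sum[symmetric] sum_distrib_left sum_distrib_right)
  finally show ?thesis
    by (simp add: sum_win_prob[OF i] mean_wins_eq[OF i])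
qed

text \<open>Markov's inequality for the exponential of the centred count. Centring leaves the
  exponent \<open>mean_wins i * (exp s - 1 - s)\<close>, which is at most
  \<open>s\<^sup>2 * (real n * p)\<close>. The sign of \<open>s\<close> selects the tail.\<close>

lemma prob_wins_signed_deviation_le:
  assumes i: "i \<in> {1..n}" and s: "\<bar>s\<bar> \<le> 1"
  shows "measure_pmf.prob (data_pmf n p \<rho>)
      {(G, Y). t \<le> s * (real (wins n G Y i) - mean_wins i)} \<le> exp (s\<^sup>2 * (real n * p) - t)"
proof -
  let ?M = "measure_pmf (data_pmf n p \<rho>)"
  let ?u = "\<lambda>(G, Y). exp (s * (real (wins n G Y i) - mean_wins i))"
  have int: "integrable ?M f" for f :: "_ \<Rightarrow> real"
    by (intro integrable_measure_pmf_finite finite_set_data_pmf)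
  have nonneg: "0 \<le> mean_wins i"
    using p range i by (auto simp: mean_wins_eq[OF i] intro!: mult_nonneg_nonneg sum_nonneg)
  have u: "?u = (\<lambda>x. exp (- (s * mean_wins i)) * (\<lambda>(G, Y). exp (s * real (wins n G Y i))) x)"
    by (auto simp: exp_add[symmetric] algebra_simps)
  have "measure_pmf.prob (data_pmf n p \<rho>) {(G, Y). t \<le> s * (real (wins n G Y i) - mean_wins i)} =
      measure ?M {x \<in> space ?M. exp t \<le> ?u x}"
    by (intro arg_cong[where f = "measure ?M"]) auto
  also have "\<dots> \<le> (\<integral>x. ?u x \<partial>?M) / exp t"
    by (rule integral_Markov_inequality_measure[where A = "space ?M"]) (auto intro: int)
  also have "(\<integral>x. ?u x \<partial>?M) =
      exp (- (s * mean_wins i)) * (\<integral>x. (\<lambda>(G, Y). exp (s * real (wins n G Y i))) x \<partial>?M)"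
    unfolding u by (rule integral_mult_right_zero)
  also have "\<dots> \<le> exp (- (s * mean_wins i)) * exp (mean_wins i * (exp s - 1))"
    using mgf_wins_le[OF i] by (intro mult_left_mono) auto
  also have "\<dots> = exp (mean_wins i * (exp s - 1 - s))"
    by (simp add: exp_add[symmetric] algebra_simps)
  also have "\<dots> \<le> exp (s\<^sup>2 * (real n * p))"
  proof -
    have "mean_wins i * (exp s - 1 - s) \<le> mean_wins i * s\<^sup>2"
      using exp_le_quadratic[OF s] nonneg by (intro mult_left_mono) auto
    also have "\<dots> \<le> (real n * p) * s\<^sup>2"
      using mean_wins_le[OF i] by (intro mult_right_mono) auto
    finally show ?thesis by (simp add: mult.commute)
  qed
  finally show ?thesis
    by (simp add: exp_diff divide_right_mono)
qed

lemma prob_wins_deviation_le: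
  assumes i: "i \<in> {1..n}" and s: "0 < s" "s \<le> 1"
  shows "measure_pmf.prob (data_pmf n p \<rho>)
      {(G, Y). t \<le> \<bar>real (wins n G Y i) - mean_wins i\<bar>} \<le> 2 * exp (s\<^sup>2 * (real n * p) - s * t)"
proof -
  let ?A = "\<lambda>s'. {(G, Y). s * t \<le> s' * (real (wins n G Y i) - mean_wins i)}"
  have "{(G, Y). t \<le> \<bar>real (wins n G Y i) - mean_wins i\<bar>} \<subseteq> ?A s \<union> ?A (- s)"
  proof safe
    fix G Y assume "t \<le> \<bar>real (wins n G Y i) - mean_wins i\<bar>"
      and "\<not> s * t \<le> - s * (real (wins n G Y i) - mean_wins i)"
    then show "s * t \<le> s * (real (wins n G Y i) - mean_wins i)"
      using s by (cases "0 \<le> real (wins n G Y i) - mean_wins i")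
        (auto intro!: mult_left_mono simp: abs_if simp flip: mult_minus_right split: if_splits)
  qed
  then have "measure_pmf.prob (data_pmf n p \<rho>)
      {(G, Y). t \<le> \<bar>real (wins n G Y i) - mean_wins i\<bar>} \<le>
      measure_pmf.prob (data_pmf n p \<rho>) (?A s \<union> ?A (- s))"
    by (intro measure_pmf.finite_measure_mono) auto
  also have "\<dots> \<le> measure_pmf.prob (data_pmf n p \<rho>) (?A s) +
      measure_pmf.prob (data_pmf n p \<rho>) (?A (- s))"
    by (rule measure_Un_le) auto
  also have "\<dots> \<le> exp (s\<^sup>2 * (real n * p) - s * t) + exp ((- s)\<^sup>2 * (real n * p) - s * t)"
    using s by (intro add_mono prob_wins_signed_deviation_le[OF i]) auto
  finally show ?thesis by simp
qed

end

subsection \<open>Laplace noise\<close>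

lemma measurable_laplace_density [measurable]: "laplace_density b \<in> borel_measurable borel"
  unfolding laplace_density_def by measurable

lemma sets_laplace [simp, measurable_cong]: "sets (laplace b) = sets borel"
  by (simp add: laplace_def)

lemma space_laplace [simp]: "space (laplace b) = UNIV"
  by (simp add: laplace_def)

lemma nn_integral_laplace_density_atLeast:
  assumes "0 < b" "0 \<le> t"
  shows "(\<integral>\<^sup>+x. ennreal (laplace_density b x) * indicator {t..} x \<partial>lborel) =
    ennreal (exp (- t / b) / 2)"
proof -
  have "(\<integral>\<^sup>+x. ennreal (laplace_density b x) * indicator {t..} x \<partial>lborel) =
      (\<integral>\<^sup>+x. ennreal (exp (- x / b) / (2 * b)) * indicator {t..} x \<partial>lborel)"
    using assms by (intro nn_integral_cong) (auto simp: laplace_density_def split: split_indicator)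
  also have "\<dots> = ennreal (0 - (- exp (- t / b) / 2))"
  proof (rule nn_integral_FTC_atLeast)
    show "((\<lambda>x. - exp (- x / b) / 2) \<longlongrightarrow> 0) at_top"
    proof -
      have "((\<lambda>x. exp (- x / b)) \<longlongrightarrow> 0) at_top"
        using \<open>0 < b\<close> by real_asymp
      from tendsto_mult_right[OF this, of "- 1 / 2"] show ?thesis by simp
    qed
  qed (use assms in \<open>auto intro!: derivative_eq_intros simp: field_simps\<close>)
  finally show ?thesis by simp
qed

lemma emeasure_laplace_abs_ge:
  assumes "0 < b" "0 \<le> t"
  shows "emeasure (laplace b) {x. t \<le> \<bar>x\<bar>} = ennreal (exp (- t / b))"
proof -
  let ?f = "\<lambda>x. ennreal (laplace_density b x)"
  have "emeasure (laplace b) {x. t \<le> \<bar>x\<bar>} = (\<integral>\<^sup>+x. ?f x * indicator {x. t \<le> \<bar>x\<bar>} x \<partial>lborel)"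
    unfolding laplace_def by (rule emeasure_density) auto
  also have "\<dots> = (\<integral>\<^sup>+x. ?f x * indicator {t..} x + ?f x * indicator {..- t} x \<partial>lborel)"
  \<comment> \<open>For \<open>t = 0\<close> the two half-lines share the point 0, so the indicators
    add up only almost everywhere.\<close>
  proof (rule nn_integral_cong_AE)
    have "AE x in lborel. x \<noteq> (0 :: real)"
      by (rule AE_lborel_singleton)
    then show "AE x in lborel. ?f x * indicator {x. t \<le> \<bar>x\<bar>} x =
        ?f x * indicator {t..} x + ?f x * indicator {..- t} x"
      by eventually_elim (use \<open>0 \<le> t\<close> in \<open>auto split: split_indicator\<close>)
  qed
  also have "\<dots> = (\<integral>\<^sup>+x. ?f x * indicator {t..} x \<partial>lborel) + (\<integral>\<^sup>+x. ?f x * indicator {..- t} x \<partial>lborel)"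
    by (rule nn_integral_add) auto
  \<comment> \<open>Reflection at 0, under which the density is even.\<close>
  also have "(\<integral>\<^sup>+x. ?f x * indicator {..- t} x \<partial>lborel) = (\<integral>\<^sup>+x. ?f x * indicator {t..} x \<partial>lborel)"
    by (subst nn_integral_real_affine[where c = "- 1" and t = 0])
       (auto simp: laplace_density_def intro!: nn_integral_cong split: split_indicator)
  finally show ?thesis
    using assms by (simp add: nn_integral_laplace_density_atLeast flip: ennreal_plus)
qed

text \<open>The tail formula at \<open>t = 0\<close> is the total mass.\<close>

lemma prob_space_laplace:
  assumes "0 < b"
  shows "prob_space (laplace b)"
  using emeasure_laplace_abs_ge[OF assms, of 0] by (intro prob_spaceI) simp

lemma emeasure_PiM_laplace_abs_ge:
  assumes "0 < b" "0 \<le> t" "i \<in> I"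
  shows "emeasure (PiM I (\<lambda>_. laplace b)) {w \<in> space (PiM I (\<lambda>_. laplace b)). t \<le> \<bar>w i\<bar>} =
    ennreal (exp (- t / b))"
proof -
  interpret L: prob_space "laplace b"
    using assms(1) by (rule prob_space_laplace)
  interpret product_prob_space "\<lambda>_. laplace b" I
    by unfold_locales
  have "emeasure (PiM I (\<lambda>_. laplace b)) {w \<in> space (PiM I (\<lambda>_. laplace b)). w i \<in> {x. t \<le> \<bar>x\<bar>}} =
      emeasure (laplace b) {x. t \<le> \<bar>x\<bar>}"
    using assms(3) by (intro emeasure_PiM_Collect_single) auto
  then show ?thesis
    using assms by (simp add: emeasure_laplace_abs_ge)
qed

subsection \<open>Recovery\<close>

lemma Theta_comparison_matrix:
  assumes "\<rho> \<in> Theta n p \<epsilon> k m c" "p \<in> {0<..1}"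
  shows "comparison_matrix n p \<rho>"
  using assms by unfold_locales (auto simp: Theta_def)

context comparison_matrix
begin

lemma tau_in_unit_interval:
  assumes "i \<in> {1..n}"
  shows "tau n \<rho> i \<in> {0..1}"
proof -
  have "(\<Sum>j\<in>{1..n}. \<rho> i j) \<le> (\<Sum>j\<in>{1..n}. 1)" "0 \<le> (\<Sum>j\<in>{1..n}. \<rho> i j)"
    using range[OF assms] by (intro sum_mono sum_nonneg; simp)+
  then show ?thesis
    using assms by (simp add: tau_def)
qed

text \<open>Caps the gap that \<open>Theta\<close> can demand; this is what excludes the sparse
  regime.\<close>

lemma tau_ord_diff_le_1:
  assumes "l \<in> {1..n}" "l' \<in> {1..n}"
  shows "tau_ord n \<rho> l - tau_ord n \<rho> l' \<le> 1"
proof -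
  have "tau_ord n \<rho> l \<in> {0..1}" "tau_ord n \<rho> l' \<in> {0..1}"
    using tau_ord_in_image[of l n \<rho>] tau_ord_in_image[of l' n \<rho>] tau_in_unit_interval assms
    by auto
  then show ?thesis by auto
qed

text \<open>Union bound over the items: \<open>A\<close> can occur only if some win count deviates
  by at least \<open>t\<close> or some noise variable by at least \<open>u\<close>.\<close>

lemma prob_model_deviation_le:
  assumes \<epsilon>: "0 < \<epsilon>" and s: "0 < s" "s \<le> 1" and u: "0 \<le> u"
    and A: "\<And>G Y W. (\<And>i. i \<in> {1..n} \<Longrightarrow> \<bar>real (wins n G Y i) - mean_wins i\<bar> < t) \<Longrightarrow>
      (\<And>i. i \<in> {1..n} \<Longrightarrow> \<bar>W i\<bar> < u) \<Longrightarrow> ((G, Y), W) \<notin> A"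
  shows "emeasure (model n p \<epsilon> \<rho>) {\<omega> \<in> space (model n p \<epsilon> \<rho>). \<omega> \<in> A} \<le>
    ennreal (real n * (2 * exp (s\<^sup>2 * (real n * p) - s * t) + exp (- (\<epsilon> * u / 2))))"
proof -
  let ?D = "measure_pmf (data_pmf n p \<rho>)" and ?P = "PiM {1..n} (\<lambda>_. laplace (2 / \<epsilon>))"
  let ?M = "model n p \<epsilon> \<rho>"
  interpret L: prob_space "laplace (2 / \<epsilon>)"
    using \<epsilon> by (intro prob_space_laplace) simp
  interpret P: prob_space ?P
    by (intro prob_space_PiM L.prob_space_axioms)
  \<comment> \<open>The bad events \<open>X i\<close> and \<open>Z i\<close> constrain only the data
    or only the noise, so each has the probability given by its own factor.\<close>
  define X where "X i = {(G, Y). t \<le> \<bar>real (wins n G Y i) - mean_wins i\<bar>} \<times> space ?P" for i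
  define Z where "Z i = space ?D \<times> {W \<in> space ?P. u \<le> \<bar>W i\<bar>}" for i
  have Z_sets: "{W \<in> space ?P. u \<le> \<bar>W i\<bar>} \<in> sets ?P" if "i \<in> {1..n}" for i
    using that by measurable
  have X: "X i \<in> sets ?M" for i
    unfolding X_def model_def by (intro pair_measureI) auto
  have Z: "Z i \<in> sets ?M" if "i \<in> {1..n}" for i
    unfolding Z_def model_def using Z_sets[OF that] by (intro pair_measureI) auto
  have eX: "emeasure ?M (X i) \<le> ennreal (2 * exp (s\<^sup>2 * (real n * p) - s * t))" if "i \<in> {1..n}" for i
    unfolding X_def model_def
    using prob_wins_deviation_le[OF that s, of t]
    by (subst P.emeasure_pair_measure_Times)
       (auto simp: P.emeasure_space_1[unfolded One_nat_def] measure_pmf.emeasure_eq_measure)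
  have eZ: "emeasure ?M (Z i) = ennreal (exp (- (\<epsilon> * u / 2)))" if "i \<in> {1..n}" for i
    unfolding Z_def model_def
    using emeasure_PiM_laplace_abs_ge[of "2 / \<epsilon>" u i "{1..n}"] \<epsilon> u that Z_sets[OF that]
    by (subst P.emeasure_pair_measure_Times) (auto simp: field_simps)
  have "{\<omega> \<in> space ?M. \<omega> \<in> A} \<subseteq> (\<Union>i\<in>{1..n}. X i \<union> Z i)"
  proof
    fix \<omega> assume \<omega>: "\<omega> \<in> {\<omega> \<in> space ?M. \<omega> \<in> A}"
    obtain G Y W where eq: "\<omega> = ((G, Y), W)"
      by (metis surj_pair)
    have W: "W \<in> space ?P"
      using \<omega> by (auto simp: eq model_def space_pair_measure)
    obtain i where "i \<in> {1..n}"
        "t \<le> \<bar>real (wins n G Y i) - mean_wins i\<bar> \<or> u \<le> \<bar>W i\<bar>"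
      using A[of G Y W] \<omega> unfolding eq by (auto simp: not_less) (meson linorder_not_less)+
    then show "\<omega> \<in> (\<Union>i\<in>{1..n}. X i \<union> Z i)"
      using W by (auto simp: eq X_def Z_def)
  qed
  \<comment> \<open>Only the covering union has to be measurable: \<open>emeasure_mono\<close> asks
    nothing of the smaller set.\<close>
  then have "emeasure ?M {\<omega> \<in> space ?M. \<omega> \<in> A} \<le> emeasure ?M (\<Union>i\<in>{1..n}. X i \<union> Z i)"
    using X Z by (intro emeasure_mono sets.finite_UN) auto
  also have "\<dots> \<le> (\<Sum>i\<in>{1..n}. emeasure ?M (X i \<union> Z i))"
    using X Z by (intro emeasure_subadditive_finite) auto
  also have "\<dots> \<le> (\<Sum>i\<in>{1..n}.
      ennreal (2 * exp (s\<^sup>2 * (real n * p) - s * t) + exp (- (\<epsilon> * u / 2))))"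
  proof (rule sum_mono)
    fix i assume i: "i \<in> {1..n}"
    have "emeasure ?M (X i \<union> Z i) \<le> emeasure ?M (X i) + emeasure ?M (Z i)"
      using X Z[OF i] by (rule emeasure_subadditive)
    also have "\<dots> \<le> ennreal (2 * exp (s\<^sup>2 * (real n * p) - s * t)) + ennreal (exp (- (\<epsilon> * u / 2)))"
      using eX[OF i] eZ[OF i] by (intro add_mono) auto
    also have "\<dots> = ennreal (2 * exp (s\<^sup>2 * (real n * p) - s * t) + exp (- (\<epsilon> * u / 2)))"
      by (rule ennreal_plus[symmetric]) auto
    finally show "emeasure ?M (X i \<union> Z i) \<le>
        ennreal (2 * exp (s\<^sup>2 * (real n * p) - s * t) + exp (- (\<epsilon> * u / 2)))" .
  qed
  also have "\<dots> = ennreal (real n * (2 * exp (s\<^sup>2 * (real n * p) - s * t) + exp (- (\<epsilon> * u / 2))))"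
    by (simp add: ennreal_mult' ennreal_of_nat_eq_real_of_nat)
  finally show ?thesis .
qed

end

lemma prob_hamming_dist_le:
  assumes k: "k \<in> {1..n - 1}" and m: "m \<le> min (k - 1) (n - k - 1)"
    and p_range: "p \<in> {0<..1}" and \<epsilon>: "0 < \<epsilon>" and r: "inj_on r {1..n}"
    and C: "24 \<le> C" and \<rho>: "\<rho> \<in> Theta n p \<epsilon> k m C"
  shows "emeasure (model n p \<epsilon> \<rho>)
      {\<omega> \<in> space (model n p \<epsilon> \<rho>). hamming_dist (S_est n r k \<omega>) (S_true n r k \<rho>) > 2 * m}
    \<le> ennreal (3 / real n ^ 5)"
proof -
  interpret comparison_matrix n p \<rho>
    using \<rho> p_range by (rule Theta_comparison_matrix)
  define L where "L = ln (real n)"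
  define s where "s = sqrt (L / (real n * p))"
  define a where "a = tau_ord n \<rho> (k - m)"
  define b where "b = tau_ord n \<rho> (k + m + 1)"
  define d where "d = L / (real n * p * \<epsilon>)"
  \<comment> \<open>Since \<open>s\<^sup>2 * (real n * p) = L\<close>, the factor 7 makes the
    Chernoff exponent \<open>L - 7 * L = - 6 * L\<close>.\<close>
  define t where "t = 7 * (real n * p * s)"
  \<comment> \<open>The noise has scale \<open>2 / \<epsilon>\<close>, so the factor 12 gives the
    tail \<open>exp (- (6 * L))\<close>, matching the wins.\<close>
  define u where "u = 12 * (L / \<epsilon>)"
  have n: "2 \<le> n" and np: "0 < real n * p" and L: "0 < L"
    using k p_range by (auto simp: L_def)
  have s: "0 < s"
    using np L by (simp add: s_def)
  have s2: "s\<^sup>2 * (real n * p) = L"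
    using np L n p_range by (simp add: s_def)
  have gap: "C * (s + d) \<le> a - b"
    using \<rho> by (simp add: Theta_def s_def d_def L_def a_def b_def)
  have nonneg: "0 \<le> d"
    using np L \<epsilon> by (simp add: d_def)
  have gap': "24 * (s + d) \<le> a - b"
    using gap C s nonneg by (intro order_trans[OF mult_right_mono gap]) auto
  \<comment> \<open>The bound on \<open>m\<close> keeps both \<open>k - m\<close> and
    \<open>k + m + 1\<close> in the index range from 1 to \<open>n\<close>.\<close>
  have "a - b \<le> 1"
    unfolding a_def b_def using k m by (intro tau_ord_diff_le_1) auto
  then have "24 * (s + d) \<le> 1"
    using gap' by (rule order_trans[rotated])
  then have s1: "s \<le> 1"
    using s nonneg by (simp add: distrib_left)
  \<comment> \<open>The constant 24 is twice the larger of 7 and 12.\<close>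
  have "2 * (t + u) \<le> 24 * (real n * p * s + L / \<epsilon>)"
    using p(1) s by (simp add: t_def u_def)
  also have "\<dots> = real n * p * (24 * (s + d))"
    using n p_range \<epsilon> by (simp add: d_def field_simps)
  also have "\<dots> \<le> real n * p * (a - b)"
    using gap' np by (intro mult_left_mono) auto
  finally have sep: "2 * (t + u) \<le> real n * p * (a - b)" .
  have close: "hamming_dist (S_est n r k ((G, Y), W)) (S_true n r k \<rho>) \<le> 2 * m"
    if wins: "\<And>i. i \<in> {1..n} \<Longrightarrow> \<bar>real (wins n G Y i) - mean_wins i\<bar> < t"
      and noise: "\<And>i. i \<in> {1..n} \<Longrightarrow> \<bar>W i\<bar> < u" for G Y W
    unfolding S_est_def S_true_def prod.case
  proof (rule hamming_dist_top_set_le[OF r])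
    show "k - m \<le> card {i \<in> {1..n}. a \<le> tau n \<rho> i}"
      unfolding a_def using k m by (intro card_ge_tau_ord) auto
    have "n + 1 - (k + m + 1) \<le> card {i \<in> {1..n}. tau n \<rho> i \<le> b}"
      unfolding b_def using k m by (intro card_le_tau_ord) auto
    then show "n - k - m \<le> card {i \<in> {1..n}. tau n \<rho> i \<le> b}"
      by simp
  next
    fix i j assume *: "i \<in> {1..n}" "j \<in> {1..n}" "a \<le> tau n \<rho> i" "tau n \<rho> j \<le> b"
    note sep
    also have "real n * p * (a - b) \<le> real n * p * (tau n \<rho> i - tau n \<rho> j)"
      using * np by (intro mult_left_mono) auto
    also have "\<dots> = mean_wins i - mean_wins j"
      by (simp add: mean_wins_def algebra_simps)
    finally have "2 * (t + u) \<le> mean_wins i - mean_wins j" .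
    \<comment> \<open>Each noisy score is strictly within \<open>t + u\<close> of its mean, so means
      at least \<open>2 * (t + u)\<close> apart keep their order.\<close>
    then show "real (wins n G Y j) + W j < real (wins n G Y i) + W i"
      using wins[OF *(1)] wins[OF *(2)] noise[OF *(1)] noise[OF *(2)]
      by (simp add: abs_less_iff)
  qed (use k in auto)
  have "emeasure (model n p \<epsilon> \<rho>)
      {\<omega> \<in> space (model n p \<epsilon> \<rho>).
        \<omega> \<in> {\<omega>. hamming_dist (S_est n r k \<omega>) (S_true n r k \<rho>) > 2 * m}}
    \<le> ennreal (real n * (2 * exp (s\<^sup>2 * (real n * p) - s * t) + exp (- (\<epsilon> * u / 2))))"
    using \<epsilon> s s1 L close by (intro prob_model_deviation_le) (auto simp: u_def not_less)
  also have "s * t = 7 * L"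
    using s2 by (simp add: t_def power2_eq_square algebra_simps)
  also have "\<epsilon> * u / 2 = 6 * L"
    using \<epsilon> by (simp add: u_def)
  also have "s\<^sup>2 * (real n * p) - 7 * L = - (6 * L)"
    using s2 by simp
  also have "exp (- (6 * L)) = 1 / real n ^ 6"
    using n by (simp add: exp_minus L_def exp_of_nat_mult[of 6, simplified] inverse_eq_divide)
  \<comment> \<open>Two win tails and one noise tail of size \<open>n\<close> to the power -6 for
    each of the \<open>n\<close> items.\<close>
  also have "real n * (2 * (1 / real n ^ 6) + 1 / real n ^ 6) = 3 / real n ^ 5"
    using n by (simp add: field_simps eval_nat_numeral)
  finally show ?thesis by simp
qed

theorem theorem2p3:
  shows "\<exists>C\<^sub>0>0. \<forall>C\<ge>C\<^sub>0. \<exists>K::real. \<forall>(n::nat) (k::nat) (m::nat) (p::real) (\<epsilon>::real) (r::nat \<Rightarrow> nat).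
    k \<in> {1..n - 1} \<longrightarrow> m \<le> min (k - 1) (n - k - 1) \<longrightarrow> p \<in> {0<..1} \<longrightarrow> \<epsilon> > 0 \<longrightarrow>
    inj_on r {1..n} \<longrightarrow>
    (SUP \<rho>\<in>Theta n p \<epsilon> k m C.
       emeasure (model n p \<epsilon> \<rho>)
         {\<omega> \<in> space (model n p \<epsilon> \<rho>).
            hamming_dist (S_est n r k \<omega>) (S_true n r k \<rho>) > 2 * m})
      \<le> ennreal (K / real n ^ 5)"
  \<comment> \<open>The threshold 24 and the bound 3 serve all parameters at once, and 3 does not
    depend on \<open>C\<close>. Over an empty class the supremum is 0, which
    \<open>SUP_least\<close> covers.\<close>
  by (intro exI[of _ 24] exI[of _ 3] conjI allI impI SUP_least prob_hamming_dist_le) simp_all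

end
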